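(* Let $I,J\subset\mathbb{R}$ be open intervals, let $f,g:I\to\mathbb{R}$ be smooth functions with $f>0$ and $-f'g'>0$ on $I$, and let $\varphi:J\to\mathbb{R}$ be a smooth function with $\dot\varphi^2+\varphi^2>0$ on $J$. Let $\mathcal{M}'''_m$ be the meridian surface of parabolic type in $\mathbb{R}^4_1$ parametrized by $$z(u,v)=f(u)\varphi(v)\cos v\,e_1+f(u)\varphi(v)\sin v\,e_2+\left(f(u)\frac{\varphi(v)^2}{2}+g(u)\right)\xi_1+f(u)\,\xi_2,\qquad u\in I,\ v\in J,$$ and suppose it is general, i.e. $\overline{\kappa}(v)\ne0$ for all $v\in J$ and $\varkappa_m(u)\neq0$ for all $u\in I$, where $$\overline{\kappa}(v)=\frac{\varphi\ddot\varphi-2\dot\varphi^2-\varphi^2}{(\dot\varphi^2+\varphi^2)^{3/2}},\qquad \varkappa_m(u)=\frac{f'g''-g'f''}{(-2f'g')^{3/2}}.$$ Then $\mathcal{M}'''_m$ is marginally trapped if and only if there is a constant $a\neq0$ such that $\overline{\kappa}(v)=a$ for all $v\in J$ and the meridian curve $u\mapsto(f(u),g(u))$ is, up to a change of the parameter, given by $$f(u)=u,\qquad g(u)=\frac{\pm1}{2a^3}\left(\frac{a^2u^2\mp2auc}{c\mp au}-2c\ln|c\mp au|+b\right)$$ for some constants $b$ and $c$ with $c\neq0$, where either all the upper signs or all the lower signs are taken (and $c\mp au\ne0$ on the parameter interval).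
   Context: $\mathbb{R}^4_1$ is $\mathbb{R}^4$ with the flat metric $\langle\cdot,\cdot\rangle=dx_1^2+dx_2^2+dx_3^2-dx_4^2$ and standard orthonormal basis $e_1,e_2,e_3,e_4$ (so $e_1^2=e_2^2=e_3^2=1$, $e_4^2=-1$). Put $\xi_1=\frac{e_3+e_4}{\sqrt2}$, $\xi_2=\frac{-e_3+e_4}{\sqrt2}$; then $\langle\xi_1,\xi_1\rangle=\langle\xi_2,\xi_2\rangle=0$ and $\langle\xi_1,\xi_2\rangle=-1$. Dots denote derivatives with respect to $v$, primes derivatives with respect to $u$. The surface in the claim is spacelike, i.e. its induced metric is Riemannian. The curve $u\mapsto(f(u),g(u))$ is called its meridian curve. For a spacelike surface $M^2$ in $\mathbb{R}^4_1$, let $\nabla'$ and $\nabla$ be the Levi-Civita connections of $\mathbb{R}^4_1$ and $M^2$, let $\sigma(x,y)=\nabla'_xy-\nabla_xy$ be the second fundamental tensor, and let $H=\frac12\operatorname{tr}\sigma$ be the mean curvature vector field. A spacelike surface is called marginally trapped if $H$ is lightlike (i.e. $H\neq0$ and $\langle H,H\rangle=0$) at each point. *)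

theory Defs
  imports "HOL-Analysis.Analysis"
begin

definition smooth_on :: "real set \<Rightarrow> (real \<Rightarrow> real) \<Rightarrow> bool" where
  "smooth_on I f \<longleftrightarrow> (\<forall>n. \<forall>x\<in>I. ((deriv ^^ n) f) differentiable (at x))"

definition open_interval :: "real set \<Rightarrow> bool" where
  "open_interval I \<longleftrightarrow> open I \<and> is_interval I \<and> I \<noteq> {}"

text \<open>The orientation may be reversed: \<open>deriv \<theta>\<close> can be negative.\<close>

definition change_of_parameter :: "real set \<Rightarrow> real set \<Rightarrow> (real \<Rightarrow> real) \<Rightarrow> bool" where
  "change_of_parameter I K \<theta> \<longleftrightarrow>
     smooth_on I \<theta> \<and> (\<forall>u\<in>I. deriv \<theta> u \<noteq> 0) \<and> bij_betw \<theta> I K"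

definition same_up_to_parameter ::
  "real set \<Rightarrow> (real \<Rightarrow> real \<times> real) \<Rightarrow> real set \<Rightarrow> (real \<Rightarrow> real \<times> real) \<Rightarrow> bool" where
  "same_up_to_parameter I \<alpha> K \<beta> \<longleftrightarrow>
     (\<exists>\<theta>. change_of_parameter I K \<theta> \<and> (\<forall>u\<in>I. \<alpha> u = \<beta> (\<theta> u)))"

definition mink :: "real^4 \<Rightarrow> real^4 \<Rightarrow> real" where
  "mink x y = x$1 * y$1 + x$2 * y$2 + x$3 * y$3 - x$4 * y$4"

definition lightlike :: "real^4 \<Rightarrow> bool" where
  "lightlike x \<longleftrightarrow> x \<noteq> 0 \<and> mink x x = 0"

text \<open>
  A surface is given by a parametrization \<open>z\<close> defined on an open subset of \<open>real^2\<close>.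
  Its tangent vector fields are represented by their components \<open>real^2 \<Rightarrow> real^2\<close> in the
  coordinate frame; \<open>tangent z X\<close> is the corresponding vector field along \<open>z\<close>.
\<close>

definition pdiff :: "2 \<Rightarrow> (real^2 \<Rightarrow> 'a::real_normed_vector) \<Rightarrow> real^2 \<Rightarrow> 'a" where
  "pdiff i F p = frechet_derivative F (at p) (axis i 1)"

definition tangent :: "(real^2 \<Rightarrow> real^4) \<Rightarrow> (real^2 \<Rightarrow> real^2) \<Rightarrow> real^2 \<Rightarrow> real^4" where
  "tangent z X p = frechet_derivative z (at p) (X p)"

definition induced_metric :: "(real^2 \<Rightarrow> real^4) \<Rightarrow> real^2 \<Rightarrow> real^2^2" where
  "induced_metric z p = (\<chi> i j. mink (pdiff i z p) (pdiff j z p))"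

definition spacelike :: "(real^2) set \<Rightarrow> (real^2 \<Rightarrow> real^4) \<Rightarrow> bool" where
  "spacelike U z \<longleftrightarrow> (\<forall>p\<in>U. \<forall>x. x \<noteq> 0 \<longrightarrow> x \<bullet> (induced_metric z p *v x) > 0)"

text \<open>
  \<open>christoffel G k i j\<close> is the \<open>k\<close>-th component of the Levi-Civita derivative of the
  \<open>j\<close>-th coordinate field along the \<open>i\<close>-th one (Koszul formula for commuting fields).
\<close>

definition christoffel :: "(real^2 \<Rightarrow> real^2^2) \<Rightarrow> 2 \<Rightarrow> 2 \<Rightarrow> 2 \<Rightarrow> real^2 \<Rightarrow> real" where
  "christoffel G k i j p =
     (1/2) * (\<Sum>l\<in>UNIV. matrix_inv (G p) $ k $ l *
       (pdiff i (\<lambda>q. G q $ j $ l) p + pdiff j (\<lambda>q. G q $ i $ l) p - pdiff l (\<lambda>q. G q $ i $ j) p))"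

definition levi_civita ::
  "(real^2 \<Rightarrow> real^2^2) \<Rightarrow> (real^2 \<Rightarrow> real^2) \<Rightarrow> (real^2 \<Rightarrow> real^2) \<Rightarrow> real^2 \<Rightarrow> real^2" where
  "levi_civita G X Y p =
     frechet_derivative Y (at p) (X p) +
     (\<chi> k. \<Sum>i\<in>UNIV. \<Sum>j\<in>UNIV. christoffel G k i j p * X p $ i * Y p $ j)"

text \<open>
  The metric of Minkowski space has constant coefficients, so its Levi-Civita connection is
  componentwise differentiation; this is the first term of \<open>second_fundamental\<close>.
\<close>

definition second_fundamental ::
  "(real^2 \<Rightarrow> real^4) \<Rightarrow> (real^2 \<Rightarrow> real^2) \<Rightarrow> (real^2 \<Rightarrow> real^2) \<Rightarrow> real^2 \<Rightarrow> real^4" where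
  "second_fundamental z X Y p =
     frechet_derivative (tangent z Y) (at p) (X p) -
     tangent z (levi_civita (induced_metric z) X Y) p"

definition mean_curvature_vector :: "(real^2 \<Rightarrow> real^4) \<Rightarrow> real^2 \<Rightarrow> real^4" where
  "mean_curvature_vector z p =
     (1/2) *\<^sub>R (\<Sum>i\<in>UNIV. \<Sum>j\<in>UNIV. (matrix_inv (induced_metric z p) $ i $ j) *\<^sub>R
       second_fundamental z (\<lambda>_. axis i 1) (\<lambda>_. axis j 1) p)"

definition marginally_trapped :: "(real^2) set \<Rightarrow> (real^2 \<Rightarrow> real^4) \<Rightarrow> bool" where
  "marginally_trapped U z \<longleftrightarrow>
     spacelike U z \<and> (\<forall>p\<in>U. lightlike (mean_curvature_vector z p))"

definition \<xi>1 :: "real^4" where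
  "\<xi>1 = (1 / sqrt 2) *\<^sub>R (axis 3 1 + axis 4 1)"

definition \<xi>2 :: "real^4" where
  "\<xi>2 = (1 / sqrt 2) *\<^sub>R (- axis 3 1 + axis 4 1)"

definition parameter_domain :: "real set \<Rightarrow> real set \<Rightarrow> (real^2) set" where
  "parameter_domain I J = {p. p $ 1 \<in> I \<and> p $ 2 \<in> J}"

definition parabolic_meridian_surface ::
  "(real \<Rightarrow> real) \<Rightarrow> (real \<Rightarrow> real) \<Rightarrow> (real \<Rightarrow> real) \<Rightarrow> real^2 \<Rightarrow> real^4" where
  "parabolic_meridian_surface f g \<phi> p =
     (let u = p $ 1; v = p $ 2 in
        (f u * \<phi> v * cos v) *\<^sub>R axis 1 1 + (f u * \<phi> v * sin v) *\<^sub>R axis 2 1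
        + (f u * ((\<phi> v)\<^sup>2 / 2) + g u) *\<^sub>R \<xi>1 + f u *\<^sub>R \<xi>2)"

definition kappa_bar :: "(real \<Rightarrow> real) \<Rightarrow> real \<Rightarrow> real" where
  "kappa_bar \<phi> v =
     (\<phi> v * deriv (deriv \<phi>) v - 2 * (deriv \<phi> v)\<^sup>2 - (\<phi> v)\<^sup>2)
       / ((deriv \<phi> v)\<^sup>2 + (\<phi> v)\<^sup>2) powr (3/2)"

definition kappa_m :: "(real \<Rightarrow> real) \<Rightarrow> (real \<Rightarrow> real) \<Rightarrow> real \<Rightarrow> real" where
  "kappa_m f g u =
     (deriv f u * deriv (deriv g) u - deriv g u * deriv (deriv f) u)
       / (- 2 * deriv f u * deriv g u) powr (3/2)"

end

theory Submission
  imports Defs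
begin

text \<open>
  Write the surface as \<open>z(u,v) = f(u) l(v) + g(u) \<xi>1\<close>, where \<open>l\<close> is the curve
  \<open>(\<phi> cos v) e1 + (\<phi> sin v) e2 + (\<phi>\<^sup>2/2) \<xi>1 + \<xi>2\<close> on the light cone. It satisfies \<open>\<langle>l,\<xi>1\<rangle> = -1\<close>
  and \<open>\<langle>l',l'\<rangle> = P = \<phi>'\<^sup>2 + \<phi>\<^sup>2\<close>. Hence the metric is \<open>E du\<^sup>2 + f\<^sup>2 P dv\<^sup>2\<close> with \<open>E = -2 f' g'\<close>.
  It is positive definite, and as the coordinate lines are orthogonal, its Christoffel symbols are
  quotients of its coefficients and their derivatives (\<open>mean_curvature_vector_orthogonal\<close>).

  Let \<open>\<kappa>\<close> and \<open>\<kappa>\<^sub>m\<close> stand for \<open>kappa_bar\<close> and \<open>kappa_m\<close>. The normal plane is spanned by a spacelike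
  direction, along which the curvature of \<open>l\<close> appears, and the timelike direction \<open>f' l - g' \<xi>1\<close>,
  along which the meridian appears. Decomposing the mean curvature vector \<open>H\<close> accordingly gives
  \<open>4 f\<^sup>2 \<langle>H,H\<rangle> = \<kappa>\<^sup>2 - (f \<kappa>\<^sub>m + \<omega>)\<^sup>2\<close> with \<open>\<omega> = f' / sqrt E\<close>
  (\<open>parabolic_meridian_surface_mean_curvature\<close>). The spacelike component is nonzero because
  \<open>\<kappa> \<noteq> 0\<close>, so being marginally trapped means that \<open>\<kappa>(v)\<^sup>2 = (f \<kappa>\<^sub>m + \<omega>)(u)\<^sup>2\<close> for all \<open>u\<close>
  and \<open>v\<close>. The variables separate: both sides are constant, and by continuity on intervals so are
  \<open>\<kappa> = a\<close> and \<open>f \<kappa>\<^sub>m + \<omega> = -\<epsilon> a\<close>, where \<open>\<epsilon>\<close> is a fixed sign.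

  The resulting differential equation for the meridian is integrated without
  reparametrizing. Since \<open>\<omega>' = f' \<kappa>\<^sub>m\<close>, one has \<open>(f \<omega>)' = f' (f \<kappa>\<^sub>m + \<omega>)\<close>, and so
  \<open>f \<kappa>\<^sub>m + \<omega> = -\<epsilon> a\<close> says that \<open>f \<omega> = c - \<epsilon> a f\<close> for a constant \<open>c\<close>. As
  \<open>2 g' \<omega>\<^sup>2 = -f'\<close>, squaring turns this into \<open>dg/df = -f\<^sup>2 / (2 (c - \<epsilon> a f)\<^sup>2)\<close>, whose
  primitives are the functions of the normal form (\<open>meridian_profile_has_real_derivative\<close>).
  Here \<open>c = 0\<close> would make \<open>\<omega>\<close> constant and thus \<open>\<kappa>\<^sub>m = 0\<close>, and the change of parameter that is
  needed is \<open>f\<close> itself. Conversely, a profile of this form yields \<open>(f \<omega>)\<^sup>2 = (c - \<epsilon> a f)\<^sup>2\<close>, and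
  differentiating gives back \<open>(f \<kappa>\<^sub>m + \<omega>)\<^sup>2 = a\<^sup>2\<close>.
\<close>


section \<open>The mean curvature vector in orthogonal coordinates\<close>

lemma mink_sym: "mink x y = mink y x" by (simp add: mink_def algebra_simps)

lemma mink_bilinear:
  "mink (x + y) w = mink x w + mink y w" "mink w (x + y) = mink w x + mink w y"
  "mink (x - y) w = mink x w - mink y w" "mink w (x - y) = mink w x - mink w y"
  "mink (r *\<^sub>R x) w = r * mink x w" "mink w (r *\<^sub>R x) = r * mink w x"
  by (simp_all add: mink_def algebra_simps)

lemma frechet_derivative_cong_open:
  assumes "open S" "p \<in> S" "\<And>q. q \<in> S \<Longrightarrow> F q = H q"
  shows "frechet_derivative F (at p) = frechet_derivative H (at p)"
proof -
  have "(F has_derivative D) (at p) \<longleftrightarrow> (H has_derivative D) (at p)" for D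
    using has_derivative_transform_within_open[OF _ assms(1,2)] assms(3) by metis
  then show ?thesis by (simp add: frechet_derivative_def)
qed

lemma pdiff_cong_open:
  assumes "open S" "p \<in> S" "\<And>q. q \<in> S \<Longrightarrow> F q = H q"
  shows "pdiff i F p = pdiff i H p"
  using frechet_derivative_cong_open[OF assms] by (simp add: pdiff_def)

lemma tangent_axis: "tangent z (\<lambda>_. axis i 1) = pdiff i z"
  by (rule ext) (simp add: tangent_def pdiff_def)

lemma separated_has_derivative:
  fixes L :: "real \<Rightarrow> 'a::real_normed_vector" and M :: 'a
  assumes "(\<alpha> has_real_derivative \<alpha>') (at (p $ 1))" "(\<beta> has_real_derivative \<beta>') (at (p $ 1))"
    and "(L has_vector_derivative L') (at (p $ 2))"
  shows "((\<lambda>q::real^2. \<alpha> (q $ 1) *\<^sub>R L (q $ 2) + \<beta> (q $ 1) *\<^sub>R M) has_derivative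
    (\<lambda>h. (h $ 1) *\<^sub>R (\<alpha>' *\<^sub>R L (p $ 2) + \<beta>' *\<^sub>R M) + (h $ 2) *\<^sub>R (\<alpha> (p $ 1) *\<^sub>R L'))) (at p)"
proof -
  have nth: "((\<lambda>q::real^2. q $ i) has_derivative (\<lambda>h. h $ i)) (at p)" for i
    by (rule bounded_linear.has_derivative[OF bounded_linear_vec_nth]) (rule has_derivative_ident)
  have a: "((\<lambda>q::real^2. \<alpha> (q $ 1)) has_derivative (\<lambda>h. \<alpha>' * h $ 1)) (at p)"
    and b: "((\<lambda>q::real^2. \<beta> (q $ 1)) has_derivative (\<lambda>h. \<beta>' * h $ 1)) (at p)"
    and l: "((\<lambda>q::real^2. L (q $ 2)) has_derivative (\<lambda>h. h $ 2 *\<^sub>R L')) (at p)"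
    using has_derivative_compose[OF nth assms(1)[unfolded has_field_derivative_def]]
      has_derivative_compose[OF nth assms(2)[unfolded has_field_derivative_def]]
      has_derivative_compose[OF nth assms(3)[unfolded has_vector_derivative_def]] by simp_all
  show ?thesis
    by (rule derivative_eq_intros a b l refl)+ (simp add: algebra_simps)
qed

text \<open>
  The surface, its coordinate tangent fields and both nonzero metric coefficients are all of the
  form \<open>\<alpha>(u) L(v) + \<beta>(u) M\<close>, so this one rule produces every partial derivative below.
\<close>

lemma separated_pdiff:
  fixes L :: "real \<Rightarrow> 'a::real_normed_vector" and M :: 'a
  assumes "open S" "p \<in> S"
    and "\<And>q. q \<in> S \<Longrightarrow> F q = \<alpha> (q $ 1) *\<^sub>R L (q $ 2) + \<beta> (q $ 1) *\<^sub>R M"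
    and "(\<alpha> has_real_derivative \<alpha>') (at (p $ 1))" "(\<beta> has_real_derivative \<beta>') (at (p $ 1))"
    and "(L has_vector_derivative L') (at (p $ 2))"
  shows "F differentiable (at p)"
    and "pdiff 1 F p = \<alpha>' *\<^sub>R L (p $ 2) + \<beta>' *\<^sub>R M"
    and "pdiff 2 F p = \<alpha> (p $ 1) *\<^sub>R L'"
proof -
  have D: "(F has_derivative
      (\<lambda>h. (h $ 1) *\<^sub>R (\<alpha>' *\<^sub>R L (p $ 2) + \<beta>' *\<^sub>R M) + (h $ 2) *\<^sub>R (\<alpha> (p $ 1) *\<^sub>R L'))) (at p)"
    by (rule has_derivative_transform_within_open[OF separated_has_derivative[OF assms(4-6)] assms(1,2)])
      (simp add: assms(3))
  then show "F differentiable (at p)" by (auto simp: differentiable_def)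
  have "frechet_derivative F (at p) =
      (\<lambda>h. (h $ 1) *\<^sub>R (\<alpha>' *\<^sub>R L (p $ 2) + \<beta>' *\<^sub>R M) + (h $ 2) *\<^sub>R (\<alpha> (p $ 1) *\<^sub>R L'))"
    using frechet_derivative_at[OF D] by simp
  then show "pdiff 1 F p = \<alpha>' *\<^sub>R L (p $ 2) + \<beta>' *\<^sub>R M" "pdiff 2 F p = \<alpha> (p $ 1) *\<^sub>R L'"
    by (simp_all add: pdiff_def axis_def)
qed

lemma matrix_inv_diagonal_2:
  fixes A :: "real^2^2"
  assumes "A $ 1 $ 2 = 0" "A $ 2 $ 1 = 0" "A $ 1 $ 1 \<noteq> 0" "A $ 2 $ 2 \<noteq> 0"
  shows "matrix_inv A $ 1 $ 1 = 1 / A $ 1 $ 1" "matrix_inv A $ 2 $ 2 = 1 / A $ 2 $ 2"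
    "matrix_inv A $ 1 $ 2 = 0" "matrix_inv A $ 2 $ 1 = 0"
proof -
  have "invertible A" using assms by (simp add: invertible_det_nz det_2)
  then have "A ** matrix_inv A = mat 1" unfolding invertible_def matrix_inv_def by (rule someI2_ex) blast
  then have "\<forall>i j. (A ** matrix_inv A) $ i $ j = (mat 1 :: real^2^2) $ i $ j" by simp
  then show "matrix_inv A $ 1 $ 1 = 1 / A $ 1 $ 1" "matrix_inv A $ 2 $ 2 = 1 / A $ 2 $ 2"
    "matrix_inv A $ 1 $ 2 = 0" "matrix_inv A $ 2 $ 1 = 0"
    using assms by (auto simp: matrix_matrix_mult_def mat_def forall_2 sum_2 field_simps)
qed

text \<open>Gauss formula: the coordinate fields have constant components, so only the Christoffel
  symbols contribute to their covariant derivatives.\<close>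

lemma second_fundamental_coordinate_fields:
  assumes "z differentiable (at p)"
  shows "second_fundamental z (\<lambda>_. axis i 1) (\<lambda>_. axis j 1) p =
    pdiff i (pdiff j z) p - (\<Sum>k\<in>UNIV. christoffel (induced_metric z) k i j p *\<^sub>R pdiff k z p)"
proof -
  let ?\<Gamma> = "\<lambda>k. christoffel (induced_metric z) k i j p"
  have ax: "axis m (1::real) $ n = (if n = m then 1 else 0)" for m n :: 2
    by (simp add: axis_def)
  have "levi_civita (induced_metric z) (\<lambda>_. axis i 1) (\<lambda>_. axis j 1) p = (\<chi> k. ?\<Gamma> k)"
    using exhaust_2[of i] exhaust_2[of j]
    unfolding levi_civita_def by (auto simp: vec_eq_iff ax sum_2)
  also have "\<dots> = (\<Sum>k\<in>UNIV. ?\<Gamma> k *\<^sub>R axis k 1)"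
    by (simp add: vec_eq_iff forall_2 sum_2 ax)
  finally have "tangent z (levi_civita (induced_metric z) (\<lambda>_. axis i 1) (\<lambda>_. axis j 1)) p =
      (\<Sum>k\<in>UNIV. ?\<Gamma> k *\<^sub>R pdiff k z p)"
    using linear_frechet_derivative[OF assms]
    by (simp add: tangent_def pdiff_def linear_sum linear_scale)
  then show ?thesis
    unfolding second_fundamental_def tangent_axis by (simp add: pdiff_def)
qed

text \<open>
  For a metric \<open>E du\<^sup>2 + G dv\<^sup>2\<close> the trace only involves the second fundamental tensor on the two
  equal pairs of coordinate fields; the coefficients of the tangent vectors are the Christoffel
  symbols with two equal lower indices.
\<close>

lemma mean_curvature_vector_orthogonal:
  fixes E G :: "real^2 \<Rightarrow> real"
  assumes "open S" "p \<in> S" and dz: "z differentiable (at p)"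
    and E: "\<And>q. q \<in> S \<Longrightarrow> mink (pdiff 1 z q) (pdiff 1 z q) = E q"
    and F: "\<And>q. q \<in> S \<Longrightarrow> mink (pdiff 1 z q) (pdiff 2 z q) = 0"
    and G: "\<And>q. q \<in> S \<Longrightarrow> mink (pdiff 2 z q) (pdiff 2 z q) = G q"
    and "E p \<noteq> 0" "G p \<noteq> 0"
  shows "mean_curvature_vector z p = (1/2) *\<^sub>R (
      (1 / E p) *\<^sub>R (pdiff 1 (pdiff 1 z) p
        - (pdiff 1 E p / (2 * E p)) *\<^sub>R pdiff 1 z p + (pdiff 2 E p / (2 * G p)) *\<^sub>R pdiff 2 z p)
    + (1 / G p) *\<^sub>R (pdiff 2 (pdiff 2 z) p
        + (pdiff 1 G p / (2 * E p)) *\<^sub>R pdiff 1 z p - (pdiff 2 G p / (2 * G p)) *\<^sub>R pdiff 2 z p))"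
proof -
  let ?g = "induced_metric z"
  have g: "?g q $ 1 $ 1 = E q" "?g q $ 1 $ 2 = 0" "?g q $ 2 $ 1 = 0" "?g q $ 2 $ 2 = G q"
    if "q \<in> S" for q
    using E[OF that] F[OF that] G[OF that] mink_sym[of "pdiff 2 z q" "pdiff 1 z q"]
    by (simp_all add: induced_metric_def)
  note inv = matrix_inv_diagonal_2[of "?g p", unfolded g[OF assms(2)], OF refl refl assms(7,8)]
  have zero: "pdiff i (\<lambda>_. 0::real) p = 0" for i by (simp add: pdiff_def)
  have d: "pdiff i (\<lambda>q. ?g q $ 1 $ 1) p = pdiff i E p" "pdiff i (\<lambda>q. ?g q $ 1 $ 2) p = 0"
    "pdiff i (\<lambda>q. ?g q $ 2 $ 1) p = 0" "pdiff i (\<lambda>q. ?g q $ 2 $ 2) p = pdiff i G p" for i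
    using pdiff_cong_open[OF assms(1,2) g(1)] pdiff_cong_open[OF assms(1,2) g(2)]
      pdiff_cong_open[OF assms(1,2) g(3)] pdiff_cong_open[OF assms(1,2) g(4)] by (simp_all add: zero)
  have c: "christoffel ?g 1 1 1 p = pdiff 1 E p / (2 * E p)"
    "christoffel ?g 2 1 1 p = - pdiff 2 E p / (2 * G p)"
    "christoffel ?g 1 2 2 p = - pdiff 1 G p / (2 * E p)"
    "christoffel ?g 2 2 2 p = pdiff 2 G p / (2 * G p)"
    by (simp_all add: christoffel_def sum_2 inv d)
  show ?thesis
    unfolding mean_curvature_vector_def second_fundamental_coordinate_fields[OF dz]
    by (simp add: sum_2 inv c algebra_simps)
qed

section \<open>The parabolic meridian surface\<close>

text \<open>Coordinates with respect to the pseudo-orthonormal frame \<open>e1, e2, \<xi>1, \<xi>2\<close>.\<close>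

definition null_frame :: "real \<Rightarrow> real \<Rightarrow> real \<Rightarrow> real \<Rightarrow> real^4" where
  "null_frame x y s t = x *\<^sub>R axis 1 1 + y *\<^sub>R axis 2 1 + s *\<^sub>R \<xi>1 + t *\<^sub>R \<xi>2"

lemma mink_null_frame:
  "mink (null_frame x y s t) (null_frame x' y' s' t') = x * x' + y * y' - s * t' - t * s'"
proof -
  have ax: "axis m (1::real) $ n = (if n = m then 1 else 0)" for m n :: 4
    by (simp add: axis_def)
  have "(1 / sqrt 2) * (1 / sqrt 2) = (1/2::real)" by simp
  then have q: "mink \<xi>1 \<xi>1 = 0" "mink \<xi>2 \<xi>2 = 0" "mink \<xi>1 \<xi>2 = -1" "mink \<xi>2 \<xi>1 = -1"
    by (simp_all add: mink_def \<xi>1_def \<xi>2_def ax)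
  have e: "mink (axis 1 1) (axis 1 1) = 1" "mink (axis 2 1) (axis 2 1) = 1"
    "mink (axis 1 1) (axis 2 1) = 0" "mink (axis 2 1) (axis 1 1) = 0"
    "mink (axis 1 1) \<xi>1 = 0" "mink (axis 2 1) \<xi>1 = 0" "mink (axis 1 1) \<xi>2 = 0" "mink (axis 2 1) \<xi>2 = 0"
    "mink \<xi>1 (axis 1 1) = 0" "mink \<xi>1 (axis 2 1) = 0" "mink \<xi>2 (axis 1 1) = 0" "mink \<xi>2 (axis 2 1) = 0"
    by (simp_all add: mink_def \<xi>1_def \<xi>2_def ax)
  show ?thesis unfolding null_frame_def by (simp add: mink_bilinear q e)
qed

lemma xi1_eq: "\<xi>1 = null_frame 0 0 1 0" by (simp add: null_frame_def)

lemma null_frame_has_vector_derivative: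
  assumes "(x has_real_derivative x') (at v)" "(y has_real_derivative y') (at v)"
    "(s has_real_derivative s') (at v)" "(t has_real_derivative t') (at v)"
  shows "((\<lambda>v. null_frame (x v) (y v) (s v) (t v)) has_vector_derivative null_frame x' y' s' t') (at v)"
  unfolding null_frame_def
  by (rule derivative_eq_intros assms refl)+ simp

text \<open>
  The curve \<open>l\<close> from which scaling by \<open>f\<close> and translating along \<open>\<xi>1\<close> sweep out the surface. It
  lies in the section \<open>\<langle>l,\<xi>1\<rangle> = -1\<close> of the light cone; the two definitions after it are its first
  two derivatives.
\<close>

definition cone_curve :: "(real \<Rightarrow> real) \<Rightarrow> real \<Rightarrow> real^4" where
  "cone_curve \<phi> v = null_frame (\<phi> v * cos v) (\<phi> v * sin v) ((\<phi> v)\<^sup>2 / 2) 1"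

definition cone_curve' :: "(real \<Rightarrow> real) \<Rightarrow> real \<Rightarrow> real^4" where
  "cone_curve' \<phi> v = null_frame (deriv \<phi> v * cos v - \<phi> v * sin v)
     (deriv \<phi> v * sin v + \<phi> v * cos v) (\<phi> v * deriv \<phi> v) 0"

definition cone_curve'' :: "(real \<Rightarrow> real) \<Rightarrow> real \<Rightarrow> real^4" where
  "cone_curve'' \<phi> v = null_frame
     (deriv (deriv \<phi>) v * cos v - 2 * deriv \<phi> v * sin v - \<phi> v * cos v)
     (deriv (deriv \<phi>) v * sin v + 2 * deriv \<phi> v * cos v - \<phi> v * sin v)
     ((deriv \<phi> v)\<^sup>2 + \<phi> v * deriv (deriv \<phi>) v) 0"

lemma parabolic_meridian_surface_eq:
  "parabolic_meridian_surface f g \<phi> p = f (p $ 1) *\<^sub>R cone_curve \<phi> (p $ 2) + g (p $ 1) *\<^sub>R \<xi>1"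
  by (simp add: parabolic_meridian_surface_def cone_curve_def null_frame_def Let_def algebra_simps)

lemma smooth_on_derivatives:
  assumes "smooth_on S f" "x \<in> S"
  shows "(f has_real_derivative deriv f x) (at x)"
    and "(deriv f has_real_derivative deriv (deriv f) x) (at x)"
    and "isCont (deriv (deriv f)) x"
proof -
  have *: "((deriv ^^ n) f) differentiable (at x)" for n
    using assms by (auto simp: smooth_on_def)
  have "f differentiable (at x)" "deriv f differentiable (at x)"
    "deriv (deriv f) differentiable (at x)"
    using *[of 0] *[of 1] *[of 2] by (simp_all add: numeral_2_eq_2)
  then show "(f has_real_derivative deriv f x) (at x)"
    "(deriv f has_real_derivative deriv (deriv f) x) (at x)" "isCont (deriv (deriv f)) x"
    by (auto simp: DERIV_deriv_iff_real_differentiable differentiable_imp_continuous_within)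
qed

lemma cone_curve_has_vector_derivative:
  assumes "smooth_on J \<phi>" "v \<in> J"
  shows "(cone_curve \<phi> has_vector_derivative cone_curve' \<phi> v) (at v)"
    and "(cone_curve' \<phi> has_vector_derivative cone_curve'' \<phi> v) (at v)"
proof -
  note D = smooth_on_derivatives[OF assms]
  show "(cone_curve \<phi> has_vector_derivative cone_curve' \<phi> v) (at v)"
    unfolding cone_curve_def[abs_def] cone_curve'_def
    by (rule null_frame_has_vector_derivative; (rule derivative_eq_intros D refl)+; simp)
  show "(cone_curve' \<phi> has_vector_derivative cone_curve'' \<phi> v) (at v)"
    unfolding cone_curve'_def[abs_def] cone_curve''_def
    by (rule null_frame_has_vector_derivative; (rule derivative_eq_intros D refl)+;
        simp add: power2_eq_square algebra_simps)
qed

text \<open>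
  The projections of \<open>l\<close> and its derivatives to the plane of \<open>e1\<close> and \<open>e2\<close> have simple components
  in the frame rotated by \<open>v\<close>, and rotations preserve inner products.
\<close>

lemma rotated_frame_inner_product:
  fixes a b c d v :: real
  shows "(a * cos v - b * sin v) * (c * cos v - d * sin v)
       + (a * sin v + b * cos v) * (c * sin v + d * cos v) = a * c + b * d" (is "?L = _")
proof -
  have "?L = (a * c + b * d) * ((sin v)\<^sup>2 + (cos v)\<^sup>2)"
    by algebra
  then show ?thesis by simp
qed

lemma mink_cone_curve:
  shows "mink \<xi>1 \<xi>1 = 0"
    "mink (cone_curve \<phi> v) \<xi>1 = -1"
    "mink (cone_curve \<phi> v) (cone_curve \<phi> v) = 0"
    "mink (cone_curve \<phi> v) (cone_curve' \<phi> v) = 0"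
    "mink (cone_curve \<phi> v) (cone_curve'' \<phi> v) = - ((deriv \<phi> v)\<^sup>2 + (\<phi> v)\<^sup>2)"
    "mink (cone_curve' \<phi> v) \<xi>1 = 0"
    "mink (cone_curve'' \<phi> v) \<xi>1 = 0"
    "mink (cone_curve' \<phi> v) (cone_curve' \<phi> v) = (deriv \<phi> v)\<^sup>2 + (\<phi> v)\<^sup>2"
    "mink (cone_curve' \<phi> v) (cone_curve'' \<phi> v) = deriv \<phi> v * (deriv (deriv \<phi>) v + \<phi> v)"
    "mink (cone_curve'' \<phi> v) (cone_curve'' \<phi> v) = (deriv (deriv \<phi>) v - \<phi> v)\<^sup>2 + 4 * (deriv \<phi> v)\<^sup>2"
  using rotated_frame_inner_product[of "\<phi> v" v 0 "\<phi> v" 0] rotated_frame_inner_product[of "\<phi> v" v 0 "deriv \<phi> v" "\<phi> v"]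
    rotated_frame_inner_product[of "\<phi> v" v 0 "deriv (deriv \<phi>) v - \<phi> v" "2 * deriv \<phi> v"]
    rotated_frame_inner_product[of "deriv \<phi> v" v "\<phi> v" "deriv \<phi> v" "\<phi> v"]
    rotated_frame_inner_product[of "deriv \<phi> v" v "\<phi> v" "deriv (deriv \<phi>) v - \<phi> v" "2 * deriv \<phi> v"]
    rotated_frame_inner_product[of "deriv (deriv \<phi>) v - \<phi> v" v "2 * deriv \<phi> v" "deriv (deriv \<phi>) v - \<phi> v" "2 * deriv \<phi> v"]
  unfolding cone_curve_def cone_curve'_def cone_curve''_def xi1_eq mink_null_frame
  by (simp_all add: algebra_simps power2_eq_square)

lemma open_parameter_domain:
  assumes "open I" "open J"
  shows "open (parameter_domain I J)"
proof -
  have "parameter_domain I J = ((\<lambda>p. p $ 1) -` I) \<inter> ((\<lambda>p. p $ 2) -` J)"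
    by (auto simp: parameter_domain_def)
  moreover have "open ((\<lambda>p::real^2. p $ i) -` A)" if "open A" for i A
    using that by (intro open_vimage continuous_intros)
  ultimately show ?thesis using assms by (simp add: open_Int)
qed

text \<open>The coefficient \<open>E = \<langle>z\<^sub>u,z\<^sub>u\<rangle>\<close> of the induced metric; the meridian has the length element
  \<open>sqrt E du\<close>.\<close>

definition sq_speed :: "(real \<Rightarrow> real) \<Rightarrow> (real \<Rightarrow> real) \<Rightarrow> real \<Rightarrow> real" where
  "sq_speed f g u = - 2 * deriv f u * deriv g u"

lemma parabolic_meridian_surface_partials:
  assumes "open I" "open J" "smooth_on I f" "smooth_on I g" "smooth_on J \<phi>"
    and p: "p \<in> parameter_domain I J"
  defines "z \<equiv> parabolic_meridian_surface f g \<phi>" and "u \<equiv> p $ 1" and "v \<equiv> p $ 2"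
  shows "z differentiable (at p)"
    and "pdiff 1 z p = deriv f u *\<^sub>R cone_curve \<phi> v + deriv g u *\<^sub>R \<xi>1"
    and "pdiff 2 z p = f u *\<^sub>R cone_curve' \<phi> v"
    and "pdiff 1 (pdiff 1 z) p = deriv (deriv f) u *\<^sub>R cone_curve \<phi> v + deriv (deriv g) u *\<^sub>R \<xi>1"
    and "pdiff 2 (pdiff 2 z) p = f u *\<^sub>R cone_curve'' \<phi> v"
proof -
  have op: "open (parameter_domain I J)" using assms(1,2) by (rule open_parameter_domain)
  have first: "z differentiable (at q)"
      "pdiff 1 z q = deriv f (q $ 1) *\<^sub>R cone_curve \<phi> (q $ 2) + deriv g (q $ 1) *\<^sub>R \<xi>1"
      "pdiff 2 z q = f (q $ 1) *\<^sub>R cone_curve' \<phi> (q $ 2)" if "q \<in> parameter_domain I J" for q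
  proof -
    have uv: "q $ 1 \<in> I" "q $ 2 \<in> J" using that by (auto simp: parameter_domain_def)
    show "z differentiable (at q)"
      "pdiff 1 z q = deriv f (q $ 1) *\<^sub>R cone_curve \<phi> (q $ 2) + deriv g (q $ 1) *\<^sub>R \<xi>1"
      "pdiff 2 z q = f (q $ 1) *\<^sub>R cone_curve' \<phi> (q $ 2)"
      using separated_pdiff[where L = "cone_curve \<phi>" and M = \<xi>1 and F = z, OF op that _
          smooth_on_derivatives(1)[OF assms(3) uv(1)] smooth_on_derivatives(1)[OF assms(4) uv(1)]
          cone_curve_has_vector_derivative(1)[OF assms(5) uv(2)]]
      by (auto simp: z_def parabolic_meridian_surface_eq)
  qed
  have uv: "u \<in> I" "v \<in> J" using p by (auto simp: parameter_domain_def u_def v_def)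
  show "z differentiable (at p)"
    "pdiff 1 z p = deriv f u *\<^sub>R cone_curve \<phi> v + deriv g u *\<^sub>R \<xi>1"
    "pdiff 2 z p = f u *\<^sub>R cone_curve' \<phi> v"
    using first[OF p] by (simp_all add: u_def v_def)
  show "pdiff 1 (pdiff 1 z) p =
      deriv (deriv f) u *\<^sub>R cone_curve \<phi> v + deriv (deriv g) u *\<^sub>R \<xi>1"
    unfolding u_def v_def
    by (rule separated_pdiff(2)[OF op p]; (rule first(2) | rule smooth_on_derivatives(2)[OF assms(3)]
        | rule smooth_on_derivatives(2)[OF assms(4)]
        | rule cone_curve_has_vector_derivative(1)[OF assms(5)])?)
      (use uv in \<open>auto simp: u_def v_def\<close>)
  show "pdiff 2 (pdiff 2 z) p = f u *\<^sub>R cone_curve'' \<phi> v"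
    unfolding u_def v_def
    using separated_pdiff(3)[where L = "cone_curve' \<phi>" and \<beta> = "\<lambda>_. 0" and \<beta>' = 0 and M = 0
        and F = "pdiff 2 z", OF op p _ smooth_on_derivatives(1)[OF assms(3)] _
        cone_curve_has_vector_derivative(2)[OF assms(5)]] first(3) uv
    by (auto simp: u_def v_def)
qed

lemma parabolic_meridian_surface_metric:
  assumes "open I" "open J" "smooth_on I f" "smooth_on I g" "smooth_on J \<phi>"
    and p: "p \<in> parameter_domain I J"
  defines "z \<equiv> parabolic_meridian_surface f g \<phi>" and "u \<equiv> p $ 1" and "v \<equiv> p $ 2"
  shows "mink (pdiff 1 z p) (pdiff 1 z p) = sq_speed f g u"
    and "mink (pdiff 1 z p) (pdiff 2 z p) = 0"
    and "mink (pdiff 2 z p) (pdiff 2 z p) = (f u)\<^sup>2 * ((deriv \<phi> v)\<^sup>2 + (\<phi> v)\<^sup>2)"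
  unfolding z_def u_def v_def parabolic_meridian_surface_partials[OF assms(1-6)]
  by (simp_all add: mink_bilinear mink_cone_curve mink_sym[of \<xi>1 "cone_curve _ _"]
      mink_sym[of \<xi>1 "cone_curve' _ _"] sq_speed_def power2_eq_square)

lemma parabolic_meridian_surface_spacelike:
  assumes "open I" "open J" "smooth_on I f" "smooth_on I g" "smooth_on J \<phi>"
    and "\<And>u. u \<in> I \<Longrightarrow> f u > 0"
    and "\<And>u. u \<in> I \<Longrightarrow> sq_speed f g u > 0"
    and "\<And>v. v \<in> J \<Longrightarrow> (deriv \<phi> v)\<^sup>2 + (\<phi> v)\<^sup>2 > 0"
  shows "spacelike (parameter_domain I J) (parabolic_meridian_surface f g \<phi>)"
  unfolding spacelike_def
proof (intro ballI allI impI)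
  fix p x :: "real^2"
  assume p: "p \<in> parameter_domain I J" and x: "x \<noteq> 0"
  let ?z = "parabolic_meridian_surface f g \<phi>"
  note m = parabolic_meridian_surface_metric[OF assms(1-5) p]
  define E where "E = sq_speed f g (p $ 1)"
  define G where "G = (f (p $ 1))\<^sup>2 * ((deriv \<phi> (p $ 2))\<^sup>2 + (\<phi> (p $ 2))\<^sup>2)"
  have uv: "p $ 1 \<in> I" "p $ 2 \<in> J" using p by (auto simp: parameter_domain_def)
  have "E > 0" "G > 0" using uv assms(6)[of "p $ 1"] assms(7,8) by (auto simp: E_def G_def)
  have "x \<bullet> (induced_metric ?z p *v x) = E * (x $ 1)\<^sup>2 + G * (x $ 2)\<^sup>2"
    using m(2) mink_sym[of "pdiff 2 ?z p" "pdiff 1 ?z p"]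
    by (simp add: inner_vec_def sum_2 matrix_vector_mult_def induced_metric_def m E_def G_def
        power2_eq_square algebra_simps)
  moreover have "x $ 1 \<noteq> 0 \<or> x $ 2 \<noteq> 0" using x by (auto simp: vec_eq_iff forall_2)
  then have "E * (x $ 1)\<^sup>2 + G * (x $ 2)\<^sup>2 > 0"
    using \<open>E > 0\<close> \<open>G > 0\<close> by (auto intro: add_pos_nonneg add_nonneg_pos)
  ultimately show "x \<bullet> (induced_metric ?z p *v x) > 0" by simp
qed

text \<open>Sorts the mean curvature vector in orthogonal coordinates by the vectors \<open>l\<close>, \<open>\<xi>1\<close> (here
  \<open>x\<close>) and the part of \<open>l''\<close> orthogonal to \<open>l'\<close>, with coefficients still to be evaluated.\<close>

lemma collect_frame_coefficients:
  fixes l x :: "'a::real_vector"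
  shows "e *\<^sub>R ((f2 *\<^sub>R l + g2 *\<^sub>R x) + h *\<^sub>R (f1 *\<^sub>R l + g1 *\<^sub>R x))
      + k *\<^sub>R (r *\<^sub>R l2 + s *\<^sub>R (f1 *\<^sub>R l + g1 *\<^sub>R x) - t *\<^sub>R (r *\<^sub>R l1))
    = (e * (f2 + h * f1) + k * (s * f1)) *\<^sub>R l + (e * (g2 + h * g1) + k * (s * g1)) *\<^sub>R x
      + (k * r) *\<^sub>R (l2 - t *\<^sub>R l1)"
  by (simp add: algebra_simps)

text \<open>
  In the first summand, \<open>f' l - g' \<xi>1\<close> is the timelike normal direction. The last summand is the
  part of \<open>l''\<close> orthogonal to \<open>l'\<close>; together with the multiple of \<open>\<xi>1\<close> it is orthogonal to \<open>l\<close>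
  and \<open>\<xi>1\<close> and thus carries the curvature of \<open>l\<close>.
\<close>

lemma parabolic_meridian_surface_mean_curvature_vector:
  assumes "open I" "open J" "smooth_on I f" "smooth_on I g" "smooth_on J \<phi>"
    and p: "p \<in> parameter_domain I J"
  defines "u \<equiv> p $ 1" and "v \<equiv> p $ 2"
  defines "E \<equiv> sq_speed f g u" and "P \<equiv> (deriv \<phi> v)\<^sup>2 + (\<phi> v)\<^sup>2"
    and "W \<equiv> deriv f u * deriv (deriv g) u - deriv g u * deriv (deriv f) u"
  assumes pos: "f u > 0" "E > 0" "P > 0"
  shows "mean_curvature_vector (parabolic_meridian_surface f g \<phi>) p = (1/2) *\<^sub>R (
      (W / E\<^sup>2 + deriv f u / (f u * E)) *\<^sub>R (deriv f u *\<^sub>R cone_curve \<phi> v - deriv g u *\<^sub>R \<xi>1)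
    + (- 1 / f u) *\<^sub>R \<xi>1
    + (1 / (f u * P)) *\<^sub>R (cone_curve'' \<phi> v
        - (deriv \<phi> v * (deriv (deriv \<phi>) v + \<phi> v) / P) *\<^sub>R cone_curve' \<phi> v))"
proof -
  let ?z = "parabolic_meridian_surface f g \<phi>"
  let ?S = "parameter_domain I J"
  let ?P = "\<lambda>v. (deriv \<phi> v)\<^sup>2 + (\<phi> v)\<^sup>2"
  have uv: "u \<in> I" "v \<in> J" using p by (auto simp: parameter_domain_def u_def v_def)
  have op: "open ?S" using assms(1,2) by (rule open_parameter_domain)
  note Df = smooth_on_derivatives[OF assms(3) uv(1)] and Dg = smooth_on_derivatives[OF assms(4) uv(1)]
    and D\<phi> = smooth_on_derivatives[OF assms(5) uv(2)]
  note z = parabolic_meridian_surface_partials[OF assms(1-5) p, folded u_def v_def]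
  note m = parabolic_meridian_surface_metric[OF assms(1-5)]
  have "(sq_speed f g has_real_derivative
      - 2 * (deriv (deriv f) u * deriv g u + deriv f u * deriv (deriv g) u)) (at u)"
    unfolding sq_speed_def[abs_def]
    by (rule derivative_eq_intros Df Dg refl)+ (simp add: algebra_simps)
  then have E: "pdiff 1 (\<lambda>q. sq_speed f g (q $ 1)) p =
      - 2 * (deriv (deriv f) u * deriv g u + deriv f u * deriv (deriv g) u)"
    "pdiff 2 (\<lambda>q. sq_speed f g (q $ 1)) p = 0"
    using separated_pdiff(2,3)[where S = UNIV and p = p and F = "\<lambda>q. sq_speed f g (q $ 1)"
        and \<alpha> = "sq_speed f g" and L = "\<lambda>_. 1" and L' = 0 and \<beta> = "\<lambda>_. 0" and \<beta>' = 0 and M = 0]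
    by (auto simp: u_def)
  have "((\<lambda>u. (f u)\<^sup>2) has_real_derivative 2 * f u * deriv f u) (at u)"
    by (rule derivative_eq_intros Df refl)+ simp
  moreover have "(?P has_real_derivative 2 * deriv \<phi> v * (deriv (deriv \<phi>) v + \<phi> v)) (at v)"
    by (rule derivative_eq_intros D\<phi> refl)+ (simp add: algebra_simps)
  ultimately have G: "pdiff 1 (\<lambda>q. (f (q $ 1))\<^sup>2 * ?P (q $ 2)) p = 2 * f u * deriv f u * P"
    "pdiff 2 (\<lambda>q. (f (q $ 1))\<^sup>2 * ?P (q $ 2)) p =
      (f u)\<^sup>2 * (2 * deriv \<phi> v * (deriv (deriv \<phi>) v + \<phi> v))"
    using separated_pdiff(2,3)[where S = UNIV and p = p and F = "\<lambda>q. (f (q $ 1))\<^sup>2 * ?P (q $ 2)"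
        and \<alpha> = "\<lambda>u. (f u)\<^sup>2" and L = ?P and \<beta> = "\<lambda>_. 0" and \<beta>' = 0 and M = 0]
    by (auto simp: u_def v_def P_def has_real_derivative_iff_has_vector_derivative)
  define l l1 l2 where "l = cone_curve \<phi> v" and "l1 = cone_curve' \<phi> v" and "l2 = cone_curve'' \<phi> v"
  define f1 g1 f2 g2 where "f1 = deriv f u" and "g1 = deriv g u"
    and "f2 = deriv (deriv f) u" and "g2 = deriv (deriv g) u"
  define d where "d = deriv \<phi> v * (deriv (deriv \<phi>) v + \<phi> v)"
  have Epos: "sq_speed f g (p $ 1) \<noteq> 0" and Gpos: "(f (p $ 1))\<^sup>2 * ?P (p $ 2) \<noteq> 0"
    using pos by (auto simp: E_def P_def u_def v_def)
  have EE: "E = - 2 * f1 * g1" by (simp add: E_def sq_speed_def f1_def g1_def)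
  define X where "X = f2 * g1 + f1 * g2"
  have c: "- 2 * X / (2 * E) = - (X / E)" "2 * f u * f1 * P / (2 * E) = f u * f1 * P / E"
    "(f u)\<^sup>2 * (2 * d) / (2 * ((f u)\<^sup>2 * P)) = d / P"
    using pos by (simp_all add: field_simps)
  have "pdiff 1 (\<lambda>q. sq_speed f g (q $ 1)) p = - 2 * X"
    "pdiff 1 (\<lambda>q. (f (q $ 1))\<^sup>2 * ?P (q $ 2)) p = 2 * f u * f1 * P"
    "pdiff 2 (\<lambda>q. (f (q $ 1))\<^sup>2 * ?P (q $ 2)) p = (f u)\<^sup>2 * (2 * d)"
    unfolding E G X_def d_def f1_def g1_def f2_def g2_def by (simp_all add: mult.assoc)
  note EG = this E(2)
  have H: "mean_curvature_vector ?z p = (1/2) *\<^sub>R (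
      (1 / E) *\<^sub>R ((f2 *\<^sub>R l + g2 *\<^sub>R \<xi>1) + ((f2 * g1 + f1 * g2) / E) *\<^sub>R (f1 *\<^sub>R l + g1 *\<^sub>R \<xi>1))
    + (1 / ((f u)\<^sup>2 * P)) *\<^sub>R (f u *\<^sub>R l2 + (f u * f1 * P / E) *\<^sub>R (f1 *\<^sub>R l + g1 *\<^sub>R \<xi>1)
        - (d / P) *\<^sub>R (f u *\<^sub>R l1)))"
    using mean_curvature_vector_orthogonal[of ?S p ?z "\<lambda>q. sq_speed f g (q $ 1)"
        "\<lambda>q. (f (q $ 1))\<^sup>2 * ?P (q $ 2)", OF op p z(1) m Epos Gpos,
        unfolded EG z, folded u_def v_def, folded E_def P_def f1_def g1_def f2_def g2_def l_def l1_def l2_def,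
        unfolded c]
    by (simp add: X_def)
  have W: "W = f1 * g2 - g1 * f2" by (simp add: W_def f1_def g1_def f2_def g2_def)
  have cl: "(1 / E) * (f2 + (f2 * g1 + f1 * g2) / E * f1) + 1 / ((f u)\<^sup>2 * P) * (f u * f1 * P / E * f1)
      = (W / E\<^sup>2 + f1 / (f u * E)) * f1"
    using pos by (simp add: W field_simps power2_eq_square) (simp add: EE algebra_simps)
  have cx: "(1 / E) * (g2 + (f2 * g1 + f1 * g2) / E * g1) + 1 / ((f u)\<^sup>2 * P) * (f u * f1 * P / E * g1)
      = - (W / E\<^sup>2 + f1 / (f u * E)) * g1 - 1 / f u"
    using pos by (simp add: W field_simps power2_eq_square) (simp add: EE algebra_simps)
  have c2: "1 / ((f u)\<^sup>2 * P) * f u = 1 / (f u * P)" using pos by (simp add: field_simps power2_eq_square)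
  have "mean_curvature_vector ?z p = (1/2) *\<^sub>R (
      ((1 / E) * (f2 + (f2 * g1 + f1 * g2) / E * f1) + 1 / ((f u)\<^sup>2 * P) * (f u * f1 * P / E * f1)) *\<^sub>R l
    + ((1 / E) * (g2 + (f2 * g1 + f1 * g2) / E * g1) + 1 / ((f u)\<^sup>2 * P) * (f u * f1 * P / E * g1)) *\<^sub>R \<xi>1
    + (1 / ((f u)\<^sup>2 * P) * f u) *\<^sub>R (l2 - (d / P) *\<^sub>R l1))"
    unfolding H collect_frame_coefficients ..
  also have "\<dots> = (1/2) *\<^sub>R ((W / E\<^sup>2 + f1 / (f u * E)) *\<^sub>R (f1 *\<^sub>R l - g1 *\<^sub>R \<xi>1)
    + (- 1 / f u) *\<^sub>R \<xi>1 + (1 / (f u * P)) *\<^sub>R (l2 - (d / P) *\<^sub>R l1))"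
    unfolding cl cx c2 by (simp add: algebra_simps)
  finally show ?thesis by (simp add: l_def l1_def l2_def f1_def g1_def d_def)
qed

lemma powr_three_halves: "(x::real) > 0 \<Longrightarrow> x powr (3/2) = x * sqrt x"
proof -
  assume "x > 0"
  then have "x powr (1 + 1/2) = x * sqrt x" by (simp only: powr_add powr_half_sqrt powr_one)
  then show ?thesis by simp
qed

text \<open>The derivative of \<open>f\<close> with respect to the arc length of the meridian.\<close>

definition meridian_slope :: "(real \<Rightarrow> real) \<Rightarrow> (real \<Rightarrow> real) \<Rightarrow> real \<Rightarrow> real" where
  "meridian_slope f g u = deriv f u / sqrt (sq_speed f g u)"

text \<open>
  The vector \<open>m\<close>, the part of \<open>l''\<close> orthogonal to \<open>l'\<close>, satisfies \<open>\<langle>m,m\<rangle> = N\<^sup>2 / P\<close>, where \<open>N\<close> is the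
  numerator of \<open>kappa_bar\<close>: this is Lagrange's identity for the planar projections of \<open>l'\<close> and
  \<open>l''\<close>, of which \<open>N\<close> is the determinant up to sign. The mixed terms between \<open>m\<close>, \<open>\<xi>1\<close> and the
  timelike direction cancel. If \<open>H = 0\<close>, pairing with \<open>\<xi>1\<close> kills the timelike component, and then
  pairing with \<open>m\<close> gives \<open>N = 0\<close>.
\<close>

lemma parabolic_meridian_surface_mean_curvature:
  assumes "open I" "open J" "smooth_on I f" "smooth_on I g" "smooth_on J \<phi>"
    and p: "p \<in> parameter_domain I J"
  defines "u \<equiv> p $ 1" and "v \<equiv> p $ 2"
    and "H \<equiv> mean_curvature_vector (parabolic_meridian_surface f g \<phi>) p"
  assumes pos: "f u > 0" "sq_speed f g u > 0" "(deriv \<phi> v)\<^sup>2 + (\<phi> v)\<^sup>2 > 0"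
  shows "4 * (f u)\<^sup>2 * mink H H = (kappa_bar \<phi> v)\<^sup>2 - (f u * kappa_m f g u + meridian_slope f g u)\<^sup>2"
    and "H = 0 \<Longrightarrow> kappa_bar \<phi> v = 0"
proof -
  define E where "E = sq_speed f g u"
  define P where "P = (deriv \<phi> v)\<^sup>2 + (\<phi> v)\<^sup>2"
  define f1 g1 where "f1 = deriv f u" and "g1 = deriv g u"
  define W where "W = f1 * deriv (deriv g) u - g1 * deriv (deriv f) u"
  define d where "d = deriv \<phi> v * (deriv (deriv \<phi>) v + \<phi> v)"
  define l l1 l2 where "l = cone_curve \<phi> v" and "l1 = cone_curve' \<phi> v" and "l2 = cone_curve'' \<phi> v"
  define m where "m = l2 - (d / P) *\<^sub>R l1"
  define A where "A = W / E\<^sup>2 + f1 / (f u * E)"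
  define N where "N = \<phi> v * deriv (deriv \<phi>) v - 2 * (deriv \<phi> v)\<^sup>2 - (\<phi> v)\<^sup>2"
  have P: "P > 0" and E: "E > 0" and f: "f u > 0" using pos by (simp_all add: P_def E_def)
  have H: "H = (1/2) *\<^sub>R (A *\<^sub>R (f1 *\<^sub>R l - g1 *\<^sub>R \<xi>1) + (- 1 / f u) *\<^sub>R \<xi>1 + (1 / (f u * P)) *\<^sub>R m)"
    unfolding H_def A_def W_def f1_def g1_def m_def d_def l_def l1_def l2_def P_def E_def u_def v_def
    by (rule parabolic_meridian_surface_mean_curvature_vector[OF assms(1-6)])
      (use pos in \<open>simp_all only: u_def v_def\<close>)
  have q: "mink l l = 0" "mink l \<xi>1 = -1" "mink \<xi>1 l = -1" "mink \<xi>1 \<xi>1 = 0"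
    "mink l m = - P" "mink m l = - P" "mink \<xi>1 m = 0" "mink m \<xi>1 = 0"
    using mink_sym[of \<xi>1 "cone_curve \<phi> v"] mink_sym[of \<xi>1 "cone_curve' \<phi> v"]
      mink_sym[of \<xi>1 "cone_curve'' \<phi> v"] mink_sym[of "cone_curve' \<phi> v" "cone_curve \<phi> v"]
      mink_sym[of "cone_curve'' \<phi> v" "cone_curve \<phi> v"]
    by (simp_all add: m_def l_def l1_def l2_def mink_bilinear mink_cone_curve P_def)
  define Q where "Q = (deriv (deriv \<phi>) v - \<phi> v)\<^sup>2 + 4 * (deriv \<phi> v)\<^sup>2"
  have ll: "mink l1 l1 = P" "mink l1 l2 = d" "mink l2 l1 = d" "mink l2 l2 = Q"
    using mink_sym[of l2 l1] by (simp_all add: l1_def l2_def mink_cone_curve P_def d_def Q_def)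
  have "mink m m = Q - d\<^sup>2 / P"
    using P by (simp add: m_def mink_bilinear ll power2_eq_square)
  also have "\<dots> = (P * Q - d\<^sup>2) / P" using P by (simp add: field_simps)
  also have "P * Q - d\<^sup>2 = N\<^sup>2" unfolding P_def Q_def N_def d_def by algebra
  finally have mm: "mink m m = N\<^sup>2 / P" .
  have kb: "kappa_bar \<phi> v = N / (P * sqrt P)"
    using P by (simp add: kappa_bar_def N_def P_def powr_three_halves)
  have km: "kappa_m f g u = W / (E * sqrt E)"
    using E by (simp add: kappa_m_def W_def f1_def g1_def E_def sq_speed_def powr_three_halves)
  have EE: "E = - 2 * f1 * g1" by (simp add: E_def sq_speed_def f1_def g1_def)
  \<comment> \<open>With the reciprocals named, \<open>\<langle>H,H\<rangle>\<close> is a polynomial in the remaining quantities.\<close>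
  define r C where "r = 1 / f u" and "C = 1 / (f u * P)"
  have H': "H = (1/2) *\<^sub>R (A *\<^sub>R (f1 *\<^sub>R l - g1 *\<^sub>R \<xi>1) + (- r) *\<^sub>R \<xi>1 + C *\<^sub>R m)"
    by (simp add: H r_def C_def)
  have "4 * mink H H = 2 * A\<^sup>2 * f1 * g1 + 2 * A * f1 * r - 2 * A * f1 * C * P + C\<^sup>2 * (N\<^sup>2 / P)"
    unfolding H' mink_bilinear q mm by algebra
  also have "\<dots> = C\<^sup>2 * (N\<^sup>2 / P) - A\<^sup>2 * E"
    using P f by (simp add: EE r_def C_def)
  finally have "(f u)\<^sup>2 * (4 * mink H H) = (f u)\<^sup>2 * (C\<^sup>2 * (N\<^sup>2 / P) - A\<^sup>2 * E)" by simp
  also have "\<dots> = N\<^sup>2 / P ^ 3 - (f u)\<^sup>2 * A\<^sup>2 * E"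
    using f by (simp add: C_def right_diff_distrib power_divide power_mult_distrib power2_eq_square power3_eq_cube)
  finally have "4 * (f u)\<^sup>2 * mink H H = N\<^sup>2 / P ^ 3 - (f u)\<^sup>2 * A\<^sup>2 * E"
    by (simp add: mult_ac)
  moreover have "(kappa_bar \<phi> v)\<^sup>2 = N\<^sup>2 / P ^ 3"
    using P by (simp add: kb power_divide power_mult_distrib power2_eq_square power3_eq_cube)
  moreover have "f u * kappa_m f g u + meridian_slope f g u = f u * A * sqrt E"
  proof -
    have "1 / sqrt E = sqrt E / E" using E by (simp add: real_div_sqrt field_simps)
    moreover have "W / (E * sqrt E) = W / E * (1 / sqrt E)" "f1 / sqrt E = f1 * (1 / sqrt E)"
      by simp_all
    ultimately have "W / (E * sqrt E) = W * sqrt E / E\<^sup>2" "f1 / sqrt E = f1 * sqrt E / E"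
      by (simp_all add: power2_eq_square)
    then show ?thesis using f
      by (simp add: km meridian_slope_def f1_def[symmetric] E_def[symmetric] A_def distrib_left distrib_right)
  qed
  ultimately show "4 * (f u)\<^sup>2 * mink H H =
      (kappa_bar \<phi> v)\<^sup>2 - (f u * kappa_m f g u + meridian_slope f g u)\<^sup>2"
    using E by (simp add: power_mult_distrib)
  show "kappa_bar \<phi> v = 0" if "H = 0"
  proof -
    have z: "mink H w = 0" for w using that by (simp add: mink_def)
    have "A * f1 = 0" using z[of \<xi>1] unfolding H by (simp add: mink_bilinear q)
    then have "N = 0" using z[of m] P f unfolding H
      by (auto simp: mink_bilinear q mm)
    then show ?thesis by (simp add: kb)
  qed
qed

text \<open>The variables separate: one side depends on the meridian only, the other on \<open>\<phi>\<close> only.\<close>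

lemma marginally_trapped_iff_curvatures:
  assumes I: "open_interval I" and J: "open_interval J"
    and sm: "smooth_on I f" "smooth_on I g" "smooth_on J \<phi>"
    and f: "\<And>u. u \<in> I \<Longrightarrow> f u > 0"
    and E: "\<And>u. u \<in> I \<Longrightarrow> sq_speed f g u > 0"
    and P: "\<And>v. v \<in> J \<Longrightarrow> (deriv \<phi> v)\<^sup>2 + (\<phi> v)\<^sup>2 > 0"
    and kb: "\<And>v. v \<in> J \<Longrightarrow> kappa_bar \<phi> v \<noteq> 0"
  shows "marginally_trapped (parameter_domain I J) (parabolic_meridian_surface f g \<phi>) \<longleftrightarrow>
    (\<forall>u\<in>I. \<forall>v\<in>J. (f u * kappa_m f g u + meridian_slope f g u)\<^sup>2 = (kappa_bar \<phi> v)\<^sup>2)"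
proof -
  let ?z = "parabolic_meridian_surface f g \<phi>"
  have op: "open I" "open J" using I J by (simp_all add: open_interval_def)
  have ll: "lightlike (mean_curvature_vector ?z p) \<longleftrightarrow>
      (f (p $ 1) * kappa_m f g (p $ 1) + meridian_slope f g (p $ 1))\<^sup>2 = (kappa_bar \<phi> (p $ 2))\<^sup>2"
    if p: "p \<in> parameter_domain I J" for p
  proof -
    have uv: "p $ 1 \<in> I" "p $ 2 \<in> J" using p by (auto simp: parameter_domain_def)
    note H = parabolic_meridian_surface_mean_curvature[OF op sm p f[OF uv(1)] E[OF uv(1)] P[OF uv(2)]]
    have "mean_curvature_vector ?z p \<noteq> 0" using H(2) kb[OF uv(2)] by blast
    moreover have "mink (mean_curvature_vector ?z p) (mean_curvature_vector ?z p) = 0 \<longleftrightarrow>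
        4 * (f (p $ 1))\<^sup>2 * mink (mean_curvature_vector ?z p) (mean_curvature_vector ?z p) = 0"
      using f[OF uv(1)] by simp
    ultimately show ?thesis unfolding lightlike_def H(1) by auto
  qed
  have "(\<chi> i. if i = 1 then u else v) \<in> parameter_domain I J" if "u \<in> I" "v \<in> J" for u v
    using that by (simp add: parameter_domain_def)
  then have "(\<forall>p\<in>parameter_domain I J. R (p $ 1) (p $ 2)) \<longleftrightarrow> (\<forall>u\<in>I. \<forall>v\<in>J. R u v)" for R
    by (fastforce simp: parameter_domain_def)
  then show ?thesis
    unfolding marginally_trapped_def
    using parabolic_meridian_surface_spacelike[OF op sm f E P] ll by simp
qed

section \<open>Integration of the meridian equation\<close>

definition meridian_profile :: "real \<Rightarrow> real \<Rightarrow> real \<Rightarrow> real \<Rightarrow> real \<Rightarrow> real" where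
  "meridian_profile \<epsilon> a b c t = \<epsilon> / (2 * a ^ 3) *
     ((a\<^sup>2 * t\<^sup>2 - \<epsilon> * 2 * a * t * c) / (c - \<epsilon> * a * t) - 2 * c * ln \<bar>c - \<epsilon> * a * t\<bar> + b)"

lemma ln_abs_has_real_derivative:
  assumes "(x::real) \<noteq> 0"
  shows "((\<lambda>x. ln \<bar>x\<bar>) has_real_derivative 1 / x) (at x)"
proof -
  have abs: "(\<lambda>x::real. ln \<bar>x\<bar>) = ln" by (auto simp: abs_if ln_minus)
  show ?thesis
  proof (cases "x > 0")
    case True
    then show ?thesis unfolding abs by (rule DERIV_ln_divide)
  next
    case False
    then have "- x > 0" using assms by simp
    then have "((\<lambda>x. ln (- x)) has_real_derivative 1 / - x * - 1) (at x)"
      by (intro DERIV_chain2[where f = ln, OF DERIV_ln_divide] derivative_intros)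
    then show ?thesis unfolding abs by (simp add: ln_minus)
  qed
qed

lemma meridian_profile_has_real_derivative:
  assumes "a \<noteq> 0" "\<epsilon>\<^sup>2 = 1" and D: "c - \<epsilon> * a * t \<noteq> 0"
  shows "(meridian_profile \<epsilon> a b c has_real_derivative - (t\<^sup>2 / (2 * (c - \<epsilon> * a * t)\<^sup>2))) (at t)"
proof -
  define d where "d = (\<lambda>t. c - \<epsilon> * a * t)"
  have d: "(d has_real_derivative - (\<epsilon> * a)) (at t)"
    unfolding d_def by (rule derivative_eq_intros refl)+ simp
  have dt: "d t \<noteq> 0" using D by (simp add: d_def)
  have ln: "((\<lambda>t. ln \<bar>d t\<bar>) has_real_derivative 1 / d t * - (\<epsilon> * a)) (at t)"
    by (rule DERIV_chain2[OF ln_abs_has_real_derivative[OF dt] d])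
  have N: "((\<lambda>t. a\<^sup>2 * t\<^sup>2 - \<epsilon> * 2 * a * t * c) has_real_derivative 2 * a\<^sup>2 * t - 2 * \<epsilon> * a * c) (at t)"
    by (rule derivative_eq_intros refl)+ simp
  have "(meridian_profile \<epsilon> a b c has_real_derivative \<epsilon> / (2 * a ^ 3) *
      (((2 * a\<^sup>2 * t - 2 * \<epsilon> * a * c) * d t - (a\<^sup>2 * t\<^sup>2 - \<epsilon> * 2 * a * t * c) * - (\<epsilon> * a)) / (d t * d t)
        - 2 * c * (1 / d t * - (\<epsilon> * a)) + 0)) (at t)"
    unfolding meridian_profile_def[abs_def] d_def
    by (rule N DERIV_cmult DERIV_add DERIV_diff DERIV_divide DERIV_const
        d[unfolded d_def] dt[unfolded d_def] ln[unfolded d_def])+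
  moreover have "\<epsilon> / (2 * a ^ 3) *
      (((2 * a\<^sup>2 * t - 2 * \<epsilon> * a * c) * d t - (a\<^sup>2 * t\<^sup>2 - \<epsilon> * 2 * a * t * c) * - (\<epsilon> * a)) / (d t * d t)
        - 2 * c * (1 / d t * - (\<epsilon> * a)) + 0) = - (t\<^sup>2 / (2 * (d t)\<^sup>2))"
  proof -
    \<comment> \<open>The quotient in the profile is \<open>d - c\<^sup>2 / d\<close>, so its derivative and that of the logarithm add up
      to \<open>d' (1 - c / d)\<^sup>2\<close>, with \<open>c - d = \<epsilon> a t\<close>.\<close>
    have "\<epsilon> * ((2 * a\<^sup>2 * t - 2 * \<epsilon> * a * c) * d t + (a\<^sup>2 * t\<^sup>2 - \<epsilon> * 2 * a * t * c) * (\<epsilon> * a)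
        + 2 * c * \<epsilon> * a * d t) = - (a ^ 3 * t\<^sup>2)"
      using assms(2) unfolding d_def by algebra
    then have "\<epsilon> * ((2 * a\<^sup>2 * t - 2 * \<epsilon> * a * c) * d t + (a\<^sup>2 * t\<^sup>2 - \<epsilon> * 2 * a * t * c) * (\<epsilon> * a)
        + 2 * c * \<epsilon> * a * d t) / (2 * a ^ 3 * (d t)\<^sup>2) = - (a ^ 3 * t\<^sup>2) / (2 * a ^ 3 * (d t)\<^sup>2)" by simp
    also have "\<dots> = - (t\<^sup>2 / (2 * (d t)\<^sup>2))" using assms(1) by simp
    finally have "\<epsilon> / (2 * a ^ 3) * ((((2 * a\<^sup>2 * t - 2 * \<epsilon> * a * c) * d t
        + (a\<^sup>2 * t\<^sup>2 - \<epsilon> * 2 * a * t * c) * (\<epsilon> * a)) + 2 * c * \<epsilon> * a * d t) / (d t)\<^sup>2)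
      = - (t\<^sup>2 / (2 * (d t)\<^sup>2))" by simp
    moreover have "(X + Y * (\<epsilon> * a) + 2 * c * \<epsilon> * a * d t) / (d t)\<^sup>2
        = (X - Y * - (\<epsilon> * a)) / (d t * d t) - 2 * c * (1 / d t * - (\<epsilon> * a)) + 0" for X Y
      using dt by (simp add: add_divide_distrib power2_eq_square)
    ultimately show ?thesis by simp
  qed
  ultimately show ?thesis unfolding d_def by simp
qed

text \<open>Up to the factor \<open>f'\<close>, which accounts for the parametrization, the curvature of the meridian
  is the derivative of \<open>\<omega> = f' / sqrt E\<close>. This makes the meridian equation integrable.\<close>

lemma meridian_slope_has_real_derivative:
  assumes "smooth_on I f" "smooth_on I g" "u \<in> I" "sq_speed f g u > 0"
  shows "(meridian_slope f g has_real_derivative deriv f u * kappa_m f g u) (at u)"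
proof -
  note Df = smooth_on_derivatives[OF assms(1,3)] and Dg = smooth_on_derivatives[OF assms(2,3)]
  define f1 g1 f2 g2 where "f1 = deriv f u" and "g1 = deriv g u"
    and "f2 = deriv (deriv f) u" and "g2 = deriv (deriv g) u"
  define s where "s = sqrt (sq_speed f g u)"
  have s: "s > 0" "s * s = - 2 * f1 * g1"
    using assms(4) by (simp_all add: s_def) (simp add: sq_speed_def f1_def g1_def)
  have "(sq_speed f g has_real_derivative - 2 * (f2 * g1 + f1 * g2)) (at u)"
    unfolding sq_speed_def[abs_def] f1_def g1_def f2_def g2_def
    by (rule derivative_eq_intros Df Dg refl)+ (simp add: algebra_simps)
  then have "((\<lambda>u. sqrt (sq_speed f g u)) has_real_derivative inverse s / 2 * (- 2 * (f2 * g1 + f1 * g2))) (at u)"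
    unfolding s_def by (rule DERIV_chain2[where f = sqrt and g = "sq_speed f g", OF DERIV_real_sqrt[OF assms(4)]])
  then have "(meridian_slope f g has_real_derivative
      (f2 * s - f1 * (inverse s / 2 * (- 2 * (f2 * g1 + f1 * g2)))) / (s * s)) (at u)"
    unfolding meridian_slope_def[abs_def] using Df(2) s(1) unfolding s_def f1_def f2_def
    by (intro DERIV_divide) auto
  moreover have "(f2 * s - f1 * (inverse s / 2 * (- 2 * (f2 * g1 + f1 * g2)))) / (s * s)
      = f1 * kappa_m f g u"
  proof -
    have "f2 * s - f1 * (inverse s / 2 * (- 2 * (f2 * g1 + f1 * g2)))
        = (f2 * (s * s) + f1 * (f2 * g1 + f1 * g2)) / s"
      using s(1) by (simp add: field_simps)
    also have "f2 * (s * s) + f1 * (f2 * g1 + f1 * g2) = f1 * (f1 * g2 - g1 * f2)"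
      unfolding s(2) by algebra
    finally have "f2 * s - f1 * (inverse s / 2 * (- 2 * (f2 * g1 + f1 * g2)))
        = f1 * (f1 * g2 - g1 * f2) / s" .
    moreover have "kappa_m f g u = (f1 * g2 - g1 * f2) / (s * s * s)"
      using powr_three_halves[OF assms(4)] s
      by (simp add: kappa_m_def f1_def g1_def f2_def g2_def sq_speed_def s_def)
    ultimately show ?thesis by (simp add: mult_ac)
  qed
  ultimately show ?thesis by (simp add: f1_def)
qed

text \<open>The sign is the same at all points because the range is finite and connected.\<close>

lemma continuous_constant_square:
  fixes h :: "real \<Rightarrow> real"
  assumes "connected S" "continuous_on S h" "\<And>x. x \<in> S \<Longrightarrow> (h x)\<^sup>2 = a\<^sup>2"
  obtains \<delta> where "\<delta> \<in> {1, -1}" "\<And>x. x \<in> S \<Longrightarrow> h x = \<delta> * a"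
proof -
  have *: "h x = a \<or> h x = - a" if "x \<in> S" for x using assms(3)[OF that] by (simp add: power2_eq_iff)
  then have "h ` S \<subseteq> {a, - a}" by auto
  then have "finite (h ` S)" by (rule finite_subset) simp
  then obtain k where k: "h x = k" if "x \<in> S" for x
    using continuous_finite_range_constant[OF assms(1,2)] by (auto simp: constant_on_def)
  show thesis
  proof (cases "S = {}")
    case True
    then show ?thesis using that[of 1] by simp
  next
    case False
    then obtain x where x: "x \<in> S" by blast
    then have "k = a \<or> k = - a" using * k by metis
    then show ?thesis using that[of 1] that[of "-1"] k by auto
  qed
qed

lemma kappa_bar_continuous_on:
  assumes "smooth_on J \<phi>" "\<And>v. v \<in> J \<Longrightarrow> (deriv \<phi> v)\<^sup>2 + (\<phi> v)\<^sup>2 > 0"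
  shows "continuous_on J (kappa_bar \<phi>)"
proof -
  have "isCont \<phi> v" "isCont (deriv \<phi>) v" "isCont (deriv (deriv \<phi>)) v" if "v \<in> J" for v
    using smooth_on_derivatives[OF assms(1) that] by (auto intro: DERIV_isCont)
  then have "continuous_on J \<phi>" "continuous_on J (deriv \<phi>)" "continuous_on J (deriv (deriv \<phi>))"
    by (simp_all add: continuous_at_imp_continuous_on)
  moreover have "(deriv \<phi> v)\<^sup>2 + (\<phi> v)\<^sup>2 \<noteq> 0" if "v \<in> J" for v using assms(2)[OF that] by linarith
  ultimately show ?thesis
    unfolding kappa_bar_def[abs_def] by (intro continuous_intros) auto
qed

lemma kappa_m_continuous_on:
  assumes "smooth_on I f" "smooth_on I g" "\<And>u. u \<in> I \<Longrightarrow> sq_speed f g u > 0"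
  shows "continuous_on I (kappa_m f g)"
proof -
  have "isCont (deriv f) u" "isCont (deriv (deriv f)) u" "isCont (deriv g) u" "isCont (deriv (deriv g)) u"
    if "u \<in> I" for u
    using smooth_on_derivatives[OF assms(1) that] smooth_on_derivatives[OF assms(2) that]
    by (auto intro: DERIV_isCont)
  then have "continuous_on I (deriv f)" "continuous_on I (deriv (deriv f))"
    "continuous_on I (deriv g)" "continuous_on I (deriv (deriv g))"
    by (simp_all add: continuous_at_imp_continuous_on)
  moreover have "- 2 * deriv f u * deriv g u \<noteq> 0" if "u \<in> I" for u
    using assms(3)[OF that] unfolding sq_speed_def by linarith
  ultimately show ?thesis
    unfolding kappa_m_def[abs_def] by (intro continuous_intros) auto
qed

lemma nonvanishing_derivative_open_interval:
  fixes f :: "real \<Rightarrow> real"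
  assumes I: "open_interval I"
    and D: "\<And>u. u \<in> I \<Longrightarrow> (f has_real_derivative f' u) (at u)" "\<And>u. u \<in> I \<Longrightarrow> f' u \<noteq> 0"
  shows "inj_on f I" "open_interval (f ` I)"
proof -
  have cont: "continuous_on I f"
    using D(1) by (auto intro: continuous_at_imp_continuous_on DERIV_isCont)
  have "f x \<noteq> f y" if "x \<in> I" "y \<in> I" "x < y" for x y
  proof
    assume "f x = f y"
    have sub: "t \<in> I" if "x \<le> t" "t \<le> y" for t
      using I \<open>x \<in> I\<close> \<open>y \<in> I\<close> that by (meson is_interval_1 open_interval_def)
    obtain t where "x < t" "t < y" "f y - f x = (y - x) * f' t"
      using MVT2[OF \<open>x < y\<close>, of f f'] D(1) sub by blast
    then show False using D(2)[OF sub[of t]] \<open>f x = f y\<close> by simp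
  qed
  then show inj: "inj_on f I" by (metis inj_onI linorder_neqE)
  have "open (f ` I)"
    using injective_eq_1d_open_map_UNIV[OF cont] I inj by (auto simp: open_interval_def)
  moreover have "is_interval (f ` I)"
    using connected_continuous_image[OF cont] I by (simp add: open_interval_def is_interval_connected_1)
  ultimately show "open_interval (f ` I)" using I by (simp add: open_interval_def)
qed

lemma meridian_slope_square:
  assumes "sq_speed f g u > 0"
  shows "meridian_slope f g u \<noteq> 0" "2 * deriv g u * (meridian_slope f g u)\<^sup>2 = - deriv f u"
    "deriv f u \<noteq> 0"
proof -
  have n: "deriv f u \<noteq> 0" "deriv g u \<noteq> 0" using assms by (auto simp: sq_speed_def)
  then show "deriv f u \<noteq> 0" "meridian_slope f g u \<noteq> 0" using assms by (simp_all add: meridian_slope_def)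
  have "(meridian_slope f g u)\<^sup>2 = (deriv f u)\<^sup>2 / sq_speed f g u"
    using assms by (simp add: meridian_slope_def power_divide)
  then show "2 * deriv g u * (meridian_slope f g u)\<^sup>2 = - deriv f u"
    using n by (simp add: sq_speed_def power2_eq_square)
qed

lemma radius_times_slope_has_real_derivative:
  assumes "smooth_on I f" "smooth_on I g" "u \<in> I" "sq_speed f g u > 0"
  shows "((\<lambda>u. f u * meridian_slope f g u) has_real_derivative
    deriv f u * (f u * kappa_m f g u + meridian_slope f g u)) (at u)"
  by (rule derivative_eq_intros smooth_on_derivatives(1)[OF assms(1,3)]
      meridian_slope_has_real_derivative[OF assms] refl)+ (simp add: algebra_simps)

text \<open>
  The quantity \<open>f \<kappa>\<^sub>m + \<omega>\<close> is continuous, hence equal to \<open>\<delta> a\<close> with a fixed sign \<open>\<delta> = -\<epsilon>\<close>, and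
  two integrations follow: \<open>f \<omega> - \<delta> a f\<close> is the constant \<open>c\<close>, and \<open>g\<close> differs from a profile
  composed with \<open>f\<close> by a constant, which is absorbed in \<open>b\<close>.
\<close>

lemma profile_of_constant_curvature:
  assumes I: "open_interval I" and sm: "smooth_on I f" "smooth_on I g"
    and f: "\<And>u. u \<in> I \<Longrightarrow> f u > 0"
    and E: "\<And>u. u \<in> I \<Longrightarrow> sq_speed f g u > 0"
    and km: "\<And>u. u \<in> I \<Longrightarrow> kappa_m f g u \<noteq> 0"
    and "a \<noteq> 0"
    and eq: "\<And>u. u \<in> I \<Longrightarrow> (f u * kappa_m f g u + meridian_slope f g u)\<^sup>2 = a\<^sup>2"
  obtains b c \<epsilon> where "\<epsilon> \<in> {1, -1}" "c \<noteq> 0" "\<And>u. u \<in> I \<Longrightarrow> c - \<epsilon> * a * f u \<noteq> 0"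
    "\<And>u. u \<in> I \<Longrightarrow> g u = meridian_profile \<epsilon> a b c (f u)"
proof -
  let ?\<omega> = "meridian_slope f g"
  have conv: "convex I" "connected I" and op: "open I" "I \<noteq> {}"
    using I by (auto simp: open_interval_def is_interval_convex_1 intro: convex_connected)
  note D\<omega> = meridian_slope_has_real_derivative[OF sm _ E]
  note Df = smooth_on_derivatives(1)[OF sm(1)]
  have "continuous_on I f" "continuous_on I ?\<omega>"
    using Df D\<omega> by (auto intro!: continuous_at_imp_continuous_on intro: DERIV_isCont)
  then have "continuous_on I (\<lambda>u. f u * kappa_m f g u + ?\<omega> u)"
    by (intro continuous_intros kappa_m_continuous_on sm E)
  then obtain \<delta> where \<delta>: "\<delta> \<in> {1, -1}" "\<And>u. u \<in> I \<Longrightarrow> f u * kappa_m f g u + ?\<omega> u = \<delta> * a"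
    using continuous_constant_square[OF conv(2)] eq by blast
  have "((\<lambda>u. f u * ?\<omega> u - \<delta> * a * f u) has_real_derivative 0) (at u within I)" if "u \<in> I" for u
    by (rule has_field_derivative_at_within)
      (rule derivative_eq_intros radius_times_slope_has_real_derivative[OF sm that E[OF that]] Df[OF that] refl
        | simp add: \<delta>(2)[OF that])+
  then obtain c where "\<forall>u\<in>I. f u * ?\<omega> u - \<delta> * a * f u = c"
    using has_field_derivative_zero_constant[OF conv(1), of "\<lambda>u. f u * ?\<omega> u - \<delta> * a * f u"] by blast
  then have c: "f u * ?\<omega> u = c - (- \<delta>) * a * f u" if "u \<in> I" for u
    using that by (auto simp: algebra_simps)
  have "c \<noteq> 0"
  proof
    assume "c = 0"
    obtain u where u: "u \<in> I" using op by blast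
    have "?\<omega> w = \<delta> * a" if "w \<in> I" for w using c[OF that] f[OF that] \<open>c = 0\<close> by simp
    then have "(?\<omega> has_real_derivative 0) (at u)"
      by (intro has_field_derivative_transform_within_open[OF DERIV_const op(1) u]) auto
    then have "deriv f u * kappa_m f g u = 0"
      by (rule DERIV_unique[OF D\<omega>[OF u u]])
    then show False using km[OF u] meridian_slope_square(3)[OF E[OF u]] by simp
  qed
  have ne: "c - (- \<delta>) * a * f u \<noteq> 0" if "u \<in> I" for u
  proof -
    have "f u * ?\<omega> u \<noteq> 0" using f[OF that] meridian_slope_square(1)[OF E[OF that]] by simp
    then show ?thesis unfolding c[OF that] .
  qed
  have "((\<lambda>u. g u - meridian_profile (- \<delta>) a 0 c (f u)) has_real_derivative 0) (at u within I)"
    if u: "u \<in> I" for u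
  proof -
    define d where "d = c - (- \<delta>) * a * f u"
    have d: "d \<noteq> 0" "d = f u * ?\<omega> u" using ne[OF u] c[OF u] by (simp_all add: d_def)
    have "2 * d\<^sup>2 * deriv g u = - (f u)\<^sup>2 * deriv f u"
      using meridian_slope_square(2)[OF E[OF u]] unfolding d(2) by algebra
    then have g': "deriv g u = - ((f u)\<^sup>2 / (2 * d\<^sup>2)) * deriv f u"
      using d(1) by (simp add: field_simps)
    have "((\<lambda>u. meridian_profile (- \<delta>) a 0 c (f u)) has_real_derivative
        - ((f u)\<^sup>2 / (2 * d\<^sup>2)) * deriv f u) (at u)"
      unfolding d_def using \<delta>(1) \<open>a \<noteq> 0\<close> ne[OF u]
      by (intro DERIV_chain2[OF meridian_profile_has_real_derivative Df[OF u]]) auto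
    then have "((\<lambda>u. g u - meridian_profile (- \<delta>) a 0 c (f u)) has_real_derivative
        deriv g u - - ((f u)\<^sup>2 / (2 * d\<^sup>2)) * deriv f u) (at u)"
      by (rule DERIV_diff[OF smooth_on_derivatives(1)[OF sm(2) u]])
    then show ?thesis
      unfolding g' diff_self by (rule has_field_derivative_at_within)
  qed
  then obtain k where k: "\<forall>u\<in>I. g u - meridian_profile (- \<delta>) a 0 c (f u) = k"
    using has_field_derivative_zero_constant[OF conv(1),
        of "\<lambda>u. g u - meridian_profile (- \<delta>) a 0 c (f u)"] by blast
  \<comment> \<open>The parameter \<open>b\<close> adds \<open>\<epsilon> b / (2 a\<^sup>3)\<close> to the profile; this has to be \<open>k\<close>, and \<open>1 / \<epsilon> = \<epsilon>\<close>.\<close>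
  have "meridian_profile (- \<delta>) a (- 2 * a ^ 3 * k * \<delta>) c t = meridian_profile (- \<delta>) a 0 c t + k" for t
    using \<delta>(1) \<open>a \<noteq> 0\<close> by (auto simp: meridian_profile_def distrib_left right_diff_distrib)
  then have "g u = meridian_profile (- \<delta>) a (- 2 * a ^ 3 * k * \<delta>) c (f u)" if "u \<in> I" for u
    using k that by (simp add: algebra_simps)
  then show thesis using that[of "- \<delta>" c] \<open>c \<noteq> 0\<close> ne \<delta>(1) by auto
qed

text \<open>
  The first derivative of the profile yields \<open>(f \<omega>)\<^sup>2 = (c - \<epsilon> a f)\<^sup>2\<close> on \<open>I\<close>. Differentiating this
  squared relation avoids determining the signs of \<open>\<omega>\<close> and \<open>c - \<epsilon> a f\<close>: it gives
  \<open>f \<omega> (f \<kappa>\<^sub>m + \<omega>) = -\<epsilon> a (c - \<epsilon> a f)\<close>, whose square is the claim.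
\<close>

lemma constant_curvature_of_profile:
  assumes "open I" and sm: "smooth_on I f" "smooth_on I g"
    and E: "\<And>u. u \<in> I \<Longrightarrow> sq_speed f g u > 0"
    and a: "a \<noteq> 0" and \<epsilon>: "\<epsilon>\<^sup>2 = 1"
    and ne: "\<And>u. u \<in> I \<Longrightarrow> c - \<epsilon> * a * f u \<noteq> 0"
    and g: "\<And>u. u \<in> I \<Longrightarrow> g u = meridian_profile \<epsilon> a b c (f u)"
    and u: "u \<in> I"
  shows "(f u * kappa_m f g u + meridian_slope f g u)\<^sup>2 = a\<^sup>2"
proof -
  let ?\<omega> = "meridian_slope f g"
  let ?d = "\<lambda>u. c - \<epsilon> * a * f u"
  note Df = smooth_on_derivatives(1)[OF sm(1)]
  have sq: "(f w * ?\<omega> w)\<^sup>2 = (?d w)\<^sup>2" if w: "w \<in> I" for w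
  proof -
    have "((\<lambda>u. meridian_profile \<epsilon> a b c (f u)) has_real_derivative
        - ((f w)\<^sup>2 / (2 * (?d w)\<^sup>2)) * deriv f w) (at w)"
      by (intro DERIV_chain2[OF meridian_profile_has_real_derivative Df[OF w]] a \<epsilon> ne[OF w])
    then have "(g has_real_derivative - ((f w)\<^sup>2 / (2 * (?d w)\<^sup>2)) * deriv f w) (at w)"
      by (rule has_field_derivative_transform_within_open[OF _ \<open>open I\<close> w]) (simp add: g)
    then have g': "deriv g w = - ((f w)\<^sup>2 / (2 * (?d w)\<^sup>2)) * deriv f w"
      by (rule DERIV_imp_deriv)
    then have "2 * deriv g w * (?d w)\<^sup>2 = - (f w)\<^sup>2 * deriv f w"
      using ne[OF w] by simp
    then have "2 * deriv g w * (?d w)\<^sup>2 = 2 * deriv g w * (f w * ?\<omega> w)\<^sup>2"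
      using meridian_slope_square(2)[OF E[OF w]] by algebra
    moreover have "deriv g w \<noteq> 0" using E[OF w] by (auto simp: sq_speed_def)
    ultimately show ?thesis by simp
  qed
  define h where "h = f u * kappa_m f g u + ?\<omega> u"
  have "((\<lambda>u. (f u * ?\<omega> u)\<^sup>2) has_real_derivative 2 * (f u * ?\<omega> u) * (deriv f u * h)) (at u)"
    unfolding h_def
    by (rule derivative_eq_intros radius_times_slope_has_real_derivative[OF sm u E[OF u]] refl)+ simp
  moreover have "((\<lambda>u. (?d u)\<^sup>2) has_real_derivative 2 * ?d u * (- \<epsilon> * a * deriv f u)) (at u)"
    by (rule derivative_eq_intros Df[OF u] refl)+ simp
  then have "((\<lambda>u. (f u * ?\<omega> u)\<^sup>2) has_real_derivative 2 * ?d u * (- \<epsilon> * a * deriv f u)) (at u)"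
    by (rule has_field_derivative_transform_within_open[OF _ \<open>open I\<close> u]) (simp add: sq)
  ultimately have "2 * (f u * ?\<omega> u) * (deriv f u * h) = 2 * ?d u * (- \<epsilon> * a * deriv f u)"
    by (rule DERIV_unique)
  then have "(f u * ?\<omega> u) * h = - \<epsilon> * a * ?d u"
    using meridian_slope_square(3)[OF E[OF u]] by algebra
  then have "(f u * ?\<omega> u)\<^sup>2 * h\<^sup>2 = (?d u)\<^sup>2 * a\<^sup>2" using \<epsilon> by algebra
  then show ?thesis using sq[OF u] ne[OF u] by (simp add: h_def)
qed

section \<open>Marginally trapped parabolic meridian surfaces\<close>

theorem theorem3p2:
  fixes I J :: "real set" and f g \<phi> :: "real \<Rightarrow> real"
  assumes "open_interval I" and "open_interval J"
    and "smooth_on I f" and "smooth_on I g" and "smooth_on J \<phi>"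
    and "\<And>u. u \<in> I \<Longrightarrow> f u > 0"
    and "\<And>u. u \<in> I \<Longrightarrow> - deriv f u * deriv g u > 0"
    and "\<And>v. v \<in> J \<Longrightarrow> (deriv \<phi> v)\<^sup>2 + (\<phi> v)\<^sup>2 > 0"
    and "\<And>v. v \<in> J \<Longrightarrow> kappa_bar \<phi> v \<noteq> 0"
    and "\<And>u. u \<in> I \<Longrightarrow> kappa_m f g u \<noteq> 0"
  shows "marginally_trapped (parameter_domain I J) (parabolic_meridian_surface f g \<phi>) \<longleftrightarrow>
    (\<exists>a::real. a \<noteq> 0 \<and> (\<forall>v\<in>J. kappa_bar \<phi> v = a) \<and>
      (\<exists>(b::real) (c::real). \<exists>\<epsilon>\<in>{1, -1::real}. \<exists>K. c \<noteq> 0 \<and> open_interval K \<and>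
        (\<forall>t\<in>K. c - \<epsilon> * a * t \<noteq> 0) \<and>
        same_up_to_parameter I (\<lambda>u. (f u, g u)) K
          (\<lambda>t. (t, \<epsilon> / (2 * a ^ 3) *
             ((a\<^sup>2 * t\<^sup>2 - \<epsilon> * 2 * a * t * c) / (c - \<epsilon> * a * t)
               - 2 * c * ln \<bar>c - \<epsilon> * a * t\<bar> + b)))))"
    (is "?trapped \<longleftrightarrow> ?normal_form")
proof -
  let ?h = "\<lambda>u. f u * kappa_m f g u + meridian_slope f g u"
  have E: "sq_speed f g u > 0" if "u \<in> I" for u using assms(7)[OF that] by (simp add: sq_speed_def)
  have trapped: "?trapped \<longleftrightarrow> (\<forall>u\<in>I. \<forall>v\<in>J. (?h u)\<^sup>2 = (kappa_bar \<phi> v)\<^sup>2)"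
    by (rule marginally_trapped_iff_curvatures[OF assms(1-6) E assms(8,9)])
  obtain u0 v0 where u0: "u0 \<in> I" and v0: "v0 \<in> J" using assms(1,2) by (auto simp: open_interval_def)
  show ?thesis
  proof
    assume ?trapped
    then have eq: "(?h u)\<^sup>2 = (kappa_bar \<phi> v)\<^sup>2" if "u \<in> I" "v \<in> J" for u v
      using trapped that by blast
    define a where "a = kappa_bar \<phi> v0"
    have a: "a \<noteq> 0" using assms(9)[OF v0] by (simp add: a_def)
    have "connected J" using assms(2) by (simp add: open_interval_def is_interval_connected_1)
    moreover have "(kappa_bar \<phi> v)\<^sup>2 = a\<^sup>2" if "v \<in> J" for v
      using eq[OF u0 that] eq[OF u0 v0] by (simp add: a_def)
    ultimately obtain \<delta> where \<delta>: "\<And>v. v \<in> J \<Longrightarrow> kappa_bar \<phi> v = \<delta> * a"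
      using continuous_constant_square[OF _ kappa_bar_continuous_on[OF assms(5,8)]] by blast
    have "\<delta> = 1" using \<delta>[OF v0] a by (simp add: a_def)
    then have kb: "\<forall>v\<in>J. kappa_bar \<phi> v = a" using \<delta> by simp
    obtain b c \<epsilon> where pr: "\<epsilon> \<in> {1, -1}" "c \<noteq> 0" "\<And>u. u \<in> I \<Longrightarrow> c - \<epsilon> * a * f u \<noteq> 0"
      "\<And>u. u \<in> I \<Longrightarrow> g u = meridian_profile \<epsilon> a b c (f u)"
      by (rule profile_of_constant_curvature[OF assms(1,3,4,6) E assms(10) a
            eq[OF _ v0, folded a_def]]) (assumption+, rule that)
    note K = nonvanishing_derivative_open_interval[OF assms(1) smooth_on_derivatives(1)[OF assms(3)]
        meridian_slope_square(3)[OF E]]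
    have "same_up_to_parameter I (\<lambda>u. (f u, g u)) (f ` I) (\<lambda>t. (t, meridian_profile \<epsilon> a b c t))"
      unfolding same_up_to_parameter_def change_of_parameter_def
      using K(1) assms(3) meridian_slope_square(3)[OF E] pr(4)
      by (intro exI[of _ f]) (auto simp: bij_betw_def)
    then show ?normal_form
      using a kb pr(1-3) K(2) unfolding meridian_profile_def by blast
  next
    assume ?normal_form
    then obtain a b c \<epsilon> K where a: "a \<noteq> 0" and kb: "\<forall>v\<in>J. kappa_bar \<phi> v = a"
      and \<epsilon>: "\<epsilon> \<in> {1, -1}" and ne: "\<forall>t\<in>K. c - \<epsilon> * a * t \<noteq> 0"
      and same: "same_up_to_parameter I (\<lambda>u. (f u, g u)) K (\<lambda>t. (t, meridian_profile \<epsilon> a b c t))"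
      unfolding meridian_profile_def by blast
    have K: "f u \<in> K" and g: "g u = meridian_profile \<epsilon> a b c (f u)" if "u \<in> I" for u
      using same that
      by (auto simp: same_up_to_parameter_def change_of_parameter_def dest: bij_betwE)
    have op: "open I" and sq: "\<epsilon>\<^sup>2 = 1" using assms(1) \<epsilon> by (auto simp: open_interval_def)
    have "(?h u)\<^sup>2 = a\<^sup>2" if u: "u \<in> I" for u
      by (rule constant_curvature_of_profile[OF op assms(3,4) E a sq _ g u]) (use ne K in auto)
    then show ?trapped using trapped kb by simp
  qed
qed

end
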